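(* Let $P,Q$ be orthogonal projections in a Hilbert space $\mathcal{H}$. Then $PQ$ is S-decomposable if and only if $P(1-Q)$ is S-decomposable, and therefore if and only if $(1-P)Q$ is S-decomposable, and if and only if $(1-P)(1-Q)$ is S-decomposable.
   Context: A bounded operator $T$ is called S-decomposable if it has a singular value (Schmidt) decomposition $T=\sum_n s_n\langle\,\cdot\,,\xi_n\rangle\psi_n$ (strong convergence), where $\{\xi_n\}$ and $\{\psi_n\}$ are orthonormal systems indexed by the same index set (possibly finite or empty; countable when $\mathcal{H}$ is separable) and $s_n>0$ for all $n$. Equivalently, $T^*T$ is diagonalizable, i.e. there is an orthonormal basis of $\mathcal{H}$ consisting of eigenvectors of $T^*T$. *)

theory Defs
  imports "HOL-Analysis.Analysis"
begin

section \<open>Complex Hilbert spaces\<close>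

text \<open>
  A complex inner product space is presented as a real one (class \<^class>\<open>real_inner\<close>, with inner
  product the real part of the complex one) carrying a compatible complex structure.  This way the norm
  and the topology are those of the library.  The complex inner product is linear in its first
  argument.  Positive definiteness is inherited from \<^class>\<open>real_inner\<close>; see \<open>cinner_self\<close> below.
\<close>

class complex_inner = real_inner +
  fixes scaleC :: "complex \<Rightarrow> 'a \<Rightarrow> 'a" (infixr "*\<^sub>C" 75)
    and cinner :: "'a \<Rightarrow> 'a \<Rightarrow> complex"
  assumes scaleC_add_right: "c *\<^sub>C (x + y) = c *\<^sub>C x + c *\<^sub>C y"
    and scaleC_add_left: "(c + d) *\<^sub>C x = c *\<^sub>C x + d *\<^sub>C x"
    and scaleC_scaleC: "c *\<^sub>C d *\<^sub>C x = (c * d) *\<^sub>C x"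
    and scaleC_of_real: "complex_of_real r *\<^sub>C x = r *\<^sub>R x"
    and cinner_add_left: "cinner (x + y) z = cinner x z + cinner y z"
    and cinner_scaleC_left: "cinner (c *\<^sub>C x) y = c * cinner x y"
    and cinner_commute: "cinner y x = cnj (cinner x y)"
    and Re_cinner: "Re (cinner x y) = inner x y"

class chilbert_space = complex_inner + complete_space

lemma cinner_self: "cinner x x = complex_of_real ((norm x)\<^sup>2)"
proof (rule complex_eqI)
  show "Re (cinner x x) = Re (complex_of_real ((norm x)\<^sup>2))"
    by (simp add: Re_cinner power2_norm_eq_inner)
  show "Im (cinner x x) = Im (complex_of_real ((norm x)\<^sup>2))"
    using cinner_commute[of x x] by (metis Im_complex_of_real Reals_cnj_iff complex_is_Real_iff)
qed

instantiation complex :: chilbert_space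
begin

definition "scaleC_complex c (x::complex) = c * x"
definition "cinner_complex (x::complex) y = x * cnj y"

instance
  by standard (auto simp: scaleC_complex_def cinner_complex_def inner_complex_def
      scaleR_conv_of_real algebra_simps)

end

section \<open>Operators\<close>

definition bounded_clinear :: "('a::complex_inner \<Rightarrow> 'a) \<Rightarrow> bool" where
  "bounded_clinear T \<longleftrightarrow> bounded_linear T \<and> (\<forall>c x. T (c *\<^sub>C x) = c *\<^sub>C T x)"

definition orthogonal_projection :: "('a::complex_inner \<Rightarrow> 'a) \<Rightarrow> bool" where
  "orthogonal_projection P \<longleftrightarrow>
     bounded_clinear P \<and> P \<circ> P = P \<and> (\<forall>x y. cinner (P x) y = cinner x (P y))"

definition orthonormal_system :: "'i set \<Rightarrow> ('i \<Rightarrow> 'a::complex_inner) \<Rightarrow> bool" where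
  "orthonormal_system I \<xi> \<longleftrightarrow> (\<forall>i\<in>I. \<forall>j\<in>I. cinner (\<xi> i) (\<xi> j) = (if i = j then 1 else 0))"

definition schmidt_decomposition ::
    "('a::complex_inner \<Rightarrow> 'a) \<Rightarrow> 'i set \<Rightarrow> ('i \<Rightarrow> real) \<Rightarrow> ('i \<Rightarrow> 'a) \<Rightarrow> ('i \<Rightarrow> 'a) \<Rightarrow> bool" where
  "schmidt_decomposition T I s \<xi> \<psi> \<longleftrightarrow>
     orthonormal_system I \<xi> \<and> orthonormal_system I \<psi> \<and> (\<forall>i\<in>I. s i > 0) \<and>
     (\<forall>x. ((\<lambda>i. s i *\<^sub>R (cinner x (\<xi> i) *\<^sub>C \<psi> i)) has_sum T x) I)"

text \<open>
  The index set has to be taken inside some type; since an orthonormal system is injectively indexed,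
  subsets of the space itself suffice, as \<open>s_decomposableI\<close> confirms.
\<close>

definition s_decomposable :: "('a::complex_inner \<Rightarrow> 'a) \<Rightarrow> bool" where
  "s_decomposable T \<longleftrightarrow>
     bounded_clinear T \<and> (\<exists>(I :: 'a set) s \<xi> \<psi>. schmidt_decomposition T I s \<xi> \<psi>)"

lemma orthonormal_system_inj_on:
  assumes "orthonormal_system I \<xi>"
  shows "inj_on \<xi> I"
proof (rule inj_onI)
  fix i j assume ij: "i \<in> I" "j \<in> I" "\<xi> i = \<xi> j"
  then have "cinner (\<xi> i) (\<xi> j) = 1"
    using assms unfolding orthonormal_system_def by metis
  then show "i = j"
    using assms ij unfolding orthonormal_system_def by (metis zero_neq_one)
qed

lemma s_decomposableI:
  fixes T :: "'a::complex_inner \<Rightarrow> 'a" and I :: "'i set"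
  assumes "bounded_clinear T" and sd: "schmidt_decomposition T I s \<xi> \<psi>"
  shows "s_decomposable T"
proof -
  define g where "g = inv_into I \<xi>"
  have inj: "inj_on \<xi> I"
    using sd orthonormal_system_inj_on unfolding schmidt_decomposition_def by blast
  then have g: "g (\<xi> i) = i" if "i \<in> I" for i
    using that by (simp add: g_def)
  have on: "orthonormal_system (\<xi> ` I) (f \<circ> g)"
    if "orthonormal_system I f" for f :: "'i \<Rightarrow> 'a"
    using that inj g unfolding orthonormal_system_def by (auto simp: inj_on_def)
  have "((\<lambda>i. (s \<circ> g) i *\<^sub>R (cinner x ((\<xi> \<circ> g) i) *\<^sub>C (\<psi> \<circ> g) i)) has_sum T x) (\<xi> ` I)" for x
  proof -
    have "((\<lambda>i. s i *\<^sub>R (cinner x (\<xi> i) *\<^sub>C \<psi> i)) has_sum T x) I"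
      using sd unfolding schmidt_decomposition_def by blast
    then show ?thesis
      unfolding has_sum_reindex[OF inj] by (rule has_sum_cong[THEN iffD1, rotated]) (simp add: g)
  qed
  then have "schmidt_decomposition T (\<xi> ` I) (s \<circ> g) (\<xi> \<circ> g) (\<psi> \<circ> g)"
    using sd on g unfolding schmidt_decomposition_def by auto
  with assms(1) show ?thesis
    unfolding s_decomposable_def by blast
qed

end

theory Submission
  imports Defs
begin

text \<open>
  If \<open>PQ\<close> has Schmidt vectors \<open>\<psi>\<^sub>n\<close> on the left, these lie in the range of \<open>P\<close> and are eigenvectors
  of \<open>PQP\<close>, while \<open>PQP\<close> vanishes on the rest of that range.  So the range of \<open>P\<close> has an orthonormal
  basis of eigenvectors of \<open>PQP\<close>.  Conversely, if \<open>B\<close> is such a basis, then \<open>Q\<close> maps it to an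
  orthogonal system, and normalizing the nonzero \<open>Q b\<close> gives Schmidt decompositions of both
  \<open>PQ\<close> and \<open>QP\<close>.  On the range of \<open>P\<close>, \<open>P(1 - Q)P\<close> is the identity minus \<open>PQP\<close>, so \<open>B\<close> serves \<open>1 - Q\<close>
  equally well.
\<close>

section \<open>Complex inner products\<close>

lemma cinner_diff_left: "cinner (x - y) z = cinner x z - cinner y z"
  using cinner_add_left[of "x - y" y z] by (simp add: algebra_simps)

lemma cinner_zero_left [simp]: "cinner 0 y = 0"
  using cinner_diff_left[of 0 0 y] by simp

lemma cinner_zero_right [simp]: "cinner y 0 = 0"
  using cinner_commute[of y 0] by simp

lemma cinner_diff_right: "cinner z (x - y) = cinner z x - cinner z y"
  by (metis cinner_commute cinner_diff_left complex_cnj_diff)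

lemma cinner_scaleC_right: "cinner x (c *\<^sub>C y) = cnj c * cinner x y"
  by (metis cinner_commute cinner_scaleC_left complex_cnj_mult)

lemma cinner_scaleR_left: "cinner (r *\<^sub>R x) y = of_real r * cinner x y"
  by (metis cinner_scaleC_left scaleC_of_real)

lemma cinner_scaleR_right: "cinner x (r *\<^sub>R y) = of_real r * cinner x y"
  by (metis cinner_scaleC_right scaleC_of_real complex_cnj_complex_of_real)

lemma scaleC_zero_left [simp]: "0 *\<^sub>C x = 0"
  using scaleC_of_real[of 0 x] by simp

lemma scaleC_one [simp]: "1 *\<^sub>C x = x"
  using scaleC_of_real[of 1 x] by simp

lemma scaleC_diff_left: "(c - d) *\<^sub>C x = c *\<^sub>C x - d *\<^sub>C x"
  using scaleC_add_left[of "c - d" d x] by (simp add: algebra_simps)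

lemma scaleC_diff_right: "c *\<^sub>C (x - y) = c *\<^sub>C x - c *\<^sub>C y"
  using scaleC_add_right[of c "x - y" y] by (simp add: algebra_simps)

lemma scaleC_zero_right [simp]: "c *\<^sub>C 0 = 0"
  using scaleC_diff_right[of c 0 0] by simp

lemma scaleC_scaleR: "c *\<^sub>C (r *\<^sub>R x) = (c * of_real r) *\<^sub>C x"
  by (metis scaleC_of_real scaleC_scaleC)

lemma scaleR_scaleC: "r *\<^sub>R (c *\<^sub>C x) = (of_real r * c) *\<^sub>C x"
  by (metis scaleC_of_real scaleC_scaleC)

text \<open>The imaginary part of a complex number is the real part of its product with -\<i>, and
  moving \<i> into the conjugate-linear second argument produces that factor. This reduces
  continuity of the complex inner product to that of the real one.\<close>

lemma cinner_eq_Complex: "cinner x y = Complex (inner x y) (inner x (\<i> *\<^sub>C y))"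
  by (rule complex_eqI) (simp_all add: Re_cinner[symmetric] cinner_scaleC_right)

lemma bounded_linear_cinner_left: "bounded_linear (\<lambda>x. cinner x y)"
  unfolding cinner_eq_Complex Complex_eq
  by (intro bounded_linear_add bounded_linear_compose[OF bounded_linear_of_real]
      bounded_linear_inner_left
      bounded_linear_compose[OF bounded_linear_mult_right])

lemma has_sum_cinner_left:
  "(f has_sum x) A \<Longrightarrow> ((\<lambda>i. cinner (f i) y) has_sum cinner x y) A"
  by (rule has_sum_bounded_linear[OF bounded_linear_cinner_left])

lemma norm_scaleC: "norm (c *\<^sub>C x) = cmod c * norm x"
proof -
  have "complex_of_real ((norm (c *\<^sub>C x))\<^sup>2) = (c * cnj c) * complex_of_real ((norm x)\<^sup>2)"
    unfolding cinner_self[symmetric] cinner_scaleC_left cinner_scaleC_right by (simp only: mult_ac)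
  also have "\<dots> = complex_of_real ((cmod c * norm x)\<^sup>2)"
    by (simp only: complex_norm_square[symmetric] power_mult_distrib of_real_mult)
  finally have "(norm (c *\<^sub>C x))\<^sup>2 = (cmod c * norm x)\<^sup>2"
    using of_real_eq_iff by blast
  then show ?thesis
    by simp
qed

lemma cinner_ext_right: "(\<And>z. cinner z x = cinner z y) \<Longrightarrow> x = y"
proof -
  assume "\<And>z. cinner z x = cinner z y"
  then have "cinner (x - y) (x - y) = 0"
    by (simp add: cinner_diff_right)
  then show "x = y"
    by (simp add: cinner_self)
qed

section \<open>Orthogonal expansions\<close>

text \<open>By Pythagoras, the squared norm of a finite block of terms is the corresponding block of
  the scalar sum. Hence the partial sums form a Cauchy net, which converges by completeness.\<close>

lemma summable_on_orthogonal:
  fixes f :: "'i \<Rightarrow> 'a::{real_inner, complete_space}"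
  assumes orth: "pairwise (\<lambda>i j. orthogonal (f i) (f j)) A"
    and summ: "(\<lambda>i. (norm (f i))\<^sup>2) summable_on A"
  shows "f summable_on A"
proof -
  let ?q = "\<lambda>i. (norm (f i))\<^sup>2"
  have "\<exists>E. eventually E (finite_subsets_at_top A) \<and>
      (\<forall>F G. E F \<and> E G \<longrightarrow> dist (sum f F) (sum f G) < e)" if "e > 0" for e :: real
  proof -
    from summ obtain S where "(?q has_sum S) A"
      unfolding summable_on_def by blast
    then have "(sum ?q \<longlongrightarrow> S) (finite_subsets_at_top A)"
      unfolding has_sum_def .
    \<comment> \<open>Two scalar errors of e^2/8 add up to (e/2)^2, so a partial sum beyond
      \<open>F0\<close> is within e/2 of the one over \<open>F0\<close>, and two such partial sums
      are within e of each other.\<close>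
    then have "eventually (\<lambda>F. dist (sum ?q F) S < e\<^sup>2 / 8) (finite_subsets_at_top A)"
      by (rule tendstoD) (use \<open>e > 0\<close> in simp)
    then obtain F0 where F0: "finite F0" "F0 \<subseteq> A"
      and "\<forall>F. finite F \<and> F0 \<subseteq> F \<and> F \<subseteq> A \<longrightarrow> dist (sum ?q F) S < e\<^sup>2 / 8"
      unfolding eventually_finite_subsets_at_top by blast
    then have close: "dist (sum ?q F) S < e\<^sup>2 / 8" if "finite F" "F0 \<subseteq> F" "F \<subseteq> A" for F
      using that by blast
    have near: "dist (sum f F) (sum f F0) < e / 2" if F: "finite F" "F0 \<subseteq> F" "F \<subseteq> A" for F
    proof -
      have "(dist (sum f F) (sum f F0))\<^sup>2 = (norm (sum f (F - F0)))\<^sup>2"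
        using F by (simp add: dist_norm sum_diff)
      also have "\<dots> = sum ?q (F - F0)"
        using F by (intro norm_sum_Pythagorean) (auto intro: pairwise_subset[OF orth])
      also have "\<dots> = sum ?q F - sum ?q F0"
        using F by (simp add: sum_diff)
      also have "\<dots> < (e / 2)\<^sup>2"
        using close[OF F] close[OF F0(1) order_refl F0(2)]
        unfolding dist_real_def power_divide abs_less_iff by simp
      finally show ?thesis
        by (rule power2_less_imp_less) (use \<open>e > 0\<close> in simp)
    qed
    have "dist (sum f F) (sum f G) < e"
      if "finite F \<and> F0 \<subseteq> F \<and> F \<subseteq> A" "finite G \<and> F0 \<subseteq> G \<and> G \<subseteq> A" for F G
      using that by (intro dist_triangle_half_l[OF near near]) auto
    moreover have "eventually (\<lambda>F. finite F \<and> F0 \<subseteq> F \<and> F \<subseteq> A) (finite_subsets_at_top A)"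
      unfolding eventually_finite_subsets_at_top using F0 by (intro exI[of _ F0]) simp
    ultimately show ?thesis
      by (intro exI[of _ "\<lambda>F. finite F \<and> F0 \<subseteq> F \<and> F \<subseteq> A"] conjI allI impI) auto
  qed
  \<comment> \<open>The partial sums are indexed by finite sets, not by natural numbers, so
    completeness is used in its filter form.\<close>
  then have "cauchy_filter (filtermap (sum f) (finite_subsets_at_top A))"
    by (simp add: cauchy_filter_metric_filtermap)
  moreover have "complete (UNIV :: 'a set)"
    by (meson Cauchy_convergent UNIV_I complete_def convergent_def)
  ultimately obtain L where "(sum f \<longlongrightarrow> L) (finite_subsets_at_top A)"
    using complete_uniform[where S=UNIV] by (force simp add: filterlim_def)
  then show ?thesis
    unfolding summable_on_def has_sum_def by blast
qed

text \<open>The hypothesis on \<open>x\<close> says that \<open>f i\<close> is the projection of \<open>x\<close> to the line spanned by \<open>f i\<close>.\<close>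

lemma summable_on_orthogonal_components:
  fixes f :: "'i \<Rightarrow> 'a::{real_inner, complete_space}"
  assumes orth: "pairwise (\<lambda>i j. orthogonal (f i) (f j)) A"
    and comp: "\<And>i. i \<in> A \<Longrightarrow> inner x (f i) = (norm (f i))\<^sup>2"
  shows "f summable_on A"
proof (rule summable_on_orthogonal[OF orth])
  \<comment> \<open>Bessel's inequality: a finite partial sum y satisfies ||y||^2 = \<langle>x,
    y\<rangle>, so Cauchy-Schwarz gives ||y|| \<le> ||x||.\<close>
  have bessel: "(\<Sum>i\<in>F. (norm (f i))\<^sup>2) \<le> (norm x)\<^sup>2" if F: "finite F" "F \<subseteq> A" for F
  proof -
    have pyth: "(norm (sum f F))\<^sup>2 = (\<Sum>i\<in>F. (norm (f i))\<^sup>2)"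
      using F by (intro norm_sum_Pythagorean) (auto intro: pairwise_subset[OF orth])
    also have "\<dots> = inner x (sum f F)"
      unfolding inner_sum_right using F comp by (intro sum.cong) auto
    also have "\<dots> \<le> norm x * norm (sum f F)"
      by (rule norm_cauchy_schwarz)
    finally have "norm (sum f F) * norm (sum f F) \<le> norm x * norm (sum f F)"
      by (simp add: power2_eq_square)
    then have "norm (sum f F) \<le> norm x"
      by (cases "sum f F = 0") auto
    then show ?thesis
      unfolding pyth[symmetric] by (simp add: power_mono)
  qed
  show "(\<lambda>i. (norm (f i))\<^sup>2) summable_on A"
    by (rule nonneg_bdd_above_summable_on) (auto intro!: bdd_aboveI2 bessel)
qed

text \<open>The sum y is the orthogonal projection of x to the closed span of the system. Equality
  of the coefficients makes \<open>x - y\<close> orthogonal to every \<open>f i\<close>; it vanishes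
  only when x lies in that span.\<close>

lemma orthonormal_system_has_sum:
  fixes f :: "'i \<Rightarrow> 'a::chilbert_space"
  assumes on: "orthonormal_system A f"
  obtains y where "((\<lambda>i. cinner x (f i) *\<^sub>C f i) has_sum y) A"
    and "\<And>i. i \<in> A \<Longrightarrow> cinner y (f i) = cinner x (f i)"
proof -
  let ?g = "\<lambda>i. cinner x (f i) *\<^sub>C f i"
  have ip: "cinner (f i) (f j) = (if i = j then 1 else 0)" if "i \<in> A" "j \<in> A" for i j
    using on that unfolding orthonormal_system_def by blast
  have "?g summable_on A"
  proof (rule summable_on_orthogonal_components)
    show "pairwise (\<lambda>i j. orthogonal (?g i) (?g j)) A"
      by (auto simp: pairwise_def orthogonal_def Re_cinner[symmetric] cinner_scaleC_left
          cinner_scaleC_right ip)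
    show "inner x (?g i) = (norm (?g i))\<^sup>2" if "i \<in> A" for i
    proof -
      have "complex_of_real ((norm (?g i))\<^sup>2) = cinner x (?g i)"
        unfolding cinner_self[symmetric] by (simp add: cinner_scaleC_left cinner_scaleC_right ip that)
      then show ?thesis
        by (metis Re_cinner Re_complex_of_real)
    qed
  qed
  then obtain y where y: "(?g has_sum y) A"
    unfolding summable_on_def by blast
  have "cinner y (f i) = cinner x (f i)" if "i \<in> A" for i
  proof -
    have "((\<lambda>j. cinner (?g j) (f i)) has_sum cinner y (f i)) A"
      by (rule has_sum_cinner_left[OF y])
    \<comment> \<open>Orthonormality kills every term with j \<noteq> i, and at j = i the two
      summands agree.\<close>
    moreover have "((\<lambda>j. cinner (?g j) (f i)) has_sum cinner x (f i)) A
        \<longleftrightarrow> ((\<lambda>j. cinner x (f j)) has_sum cinner x (f i)) {i}"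
      by (rule has_sum_cong_neutral) (use that in \<open>auto simp: cinner_scaleC_left ip\<close>)
    moreover have "((\<lambda>j. cinner x (f j)) has_sum cinner x (f i)) {i}"
      using has_sum_finite[of "{i}" "\<lambda>j. cinner x (f j)"] by simp
    ultimately show ?thesis
      using has_sum_unique by blast
  qed
  with y show ?thesis
    by (rule that)
qed

text \<open>Zorn's lemma gives a maximal orthonormal set between \<open>A\<close> and
  \<open>S\<close>. A nonzero vector of \<open>S\<close> orthogonal to it could be normalized,
  remaining in \<open>S\<close> by \<open>scale\<close>, and adjoined, against maximality.\<close>

lemma orthonormal_set_extend:
  fixes A S :: "'a::complex_inner set"
  assumes "orthonormal_system A (\<lambda>b. b)" and "A \<subseteq> S"
    and scale: "\<And>c x. x \<in> S \<Longrightarrow> c *\<^sub>C x \<in> S"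
  obtains B where "A \<subseteq> B" "B \<subseteq> S" "orthonormal_system B (\<lambda>b. b)"
    and "\<And>x. x \<in> S \<Longrightarrow> (\<And>b. b \<in> B \<Longrightarrow> cinner x b = 0) \<Longrightarrow> x = 0"
proof -
  let ?F = "{B. A \<subseteq> B \<and> B \<subseteq> S \<and> orthonormal_system B (\<lambda>b. b)}"
  have "\<exists>M\<in>?F. \<forall>X\<in>?F. M \<subseteq> X \<longrightarrow> X = M"
  proof (rule subset_Zorn_nonempty)
    show "?F \<noteq> {}"
      using assms(1,2) by blast
    fix \<C> assume ne: "\<C> \<noteq> {}" and ch: "subset.chain ?F \<C>"
    have sub: "\<C> \<subseteq> ?F" and lin: "\<And>X Y. X \<in> \<C> \<Longrightarrow> Y \<in> \<C> \<Longrightarrow> X \<subseteq> Y \<or> Y \<subseteq> X"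
      using ch unfolding subset.chain_def by blast+
    \<comment> \<open>Any two vectors of the union of a chain already lie in a common
      member.\<close>
    have "cinner a b = (if a = b then 1 else 0)" if X: "X \<in> \<C>" "a \<in> X" and Y: "Y \<in> \<C>" "b \<in> Y" for X Y a b
    proof -
      obtain Z where "Z \<in> \<C>" "a \<in> Z" "b \<in> Z"
        using lin[OF X(1) Y(1)] X Y by blast
      then show ?thesis
        using sub unfolding orthonormal_system_def by blast
    qed
    then have "orthonormal_system (\<Union>\<C>) (\<lambda>b. b)"
      unfolding orthonormal_system_def by blast
    then show "\<Union>\<C> \<in> ?F"
      using ne sub by blast
  qed
  then obtain B where "B \<in> ?F" and max: "\<forall>X\<in>?F. B \<subseteq> X \<longrightarrow> X = B" ..
  then have B: "A \<subseteq> B" "B \<subseteq> S" "orthonormal_system B (\<lambda>b. b)"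
    by simp_all
  have "x = 0" if x: "x \<in> S" and perp: "\<And>b. b \<in> B \<Longrightarrow> cinner x b = 0" for x
  proof (rule ccontr)
    assume "x \<noteq> 0"
    define u where "u = complex_of_real (1 / norm x) *\<^sub>C x"
    have "u \<in> S"
      unfolding u_def by (rule scale[OF x])
    have uu: "cinner u u = 1"
      using \<open>x \<noteq> 0\<close> by (simp add: u_def cinner_self norm_scaleC norm_divide)
    have ub: "cinner u b = 0" if "b \<in> B" for b
      by (simp add: u_def cinner_scaleC_left perp that)
    have bu: "cinner b u = 0" if "b \<in> B" for b
      using ub[OF that] cinner_commute[of b u] by simp
    have "u \<notin> B"
      using ub uu by force
    have "orthonormal_system (insert u B) (\<lambda>b. b)"
      using B(3) uu ub bu \<open>u \<notin> B\<close> unfolding orthonormal_system_def by auto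
    then have "insert u B = B"
      using B \<open>u \<in> S\<close> by (intro max[rule_format]) auto
    with \<open>u \<notin> B\<close> show False
      by blast
  qed
  with B show ?thesis
    by (rule that)
qed

section \<open>Orthogonal projections\<close>

lemma bounded_clinear_compose:
  "bounded_clinear S \<Longrightarrow> bounded_clinear T \<Longrightarrow> bounded_clinear (S \<circ> T)"
  unfolding bounded_clinear_def o_def by (auto intro: bounded_linear_compose)

lemma bounded_clinear_complement:
  "bounded_clinear T \<Longrightarrow> bounded_clinear (\<lambda>x. x - T x)"
  unfolding bounded_clinear_def
  by (simp add: bounded_linear_sub bounded_linear_ident scaleC_diff_right)

context
  fixes P :: "'a::complex_inner \<Rightarrow> 'a"
  assumes P: "orthogonal_projection P"
begin

lemma projection_bounded_clinear: "bounded_clinear P"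
  using P unfolding orthogonal_projection_def by blast

lemma projection_bounded_linear: "bounded_linear P"
  using projection_bounded_clinear unfolding bounded_clinear_def by blast

lemma projection_scaleC: "P (c *\<^sub>C x) = c *\<^sub>C P x"
  using projection_bounded_clinear unfolding bounded_clinear_def by blast

lemma projection_scaleR: "P (r *\<^sub>R x) = r *\<^sub>R P x"
  by (metis projection_scaleC scaleC_of_real)

lemma projection_diff: "P (x - y) = P x - P y"
  using projection_bounded_linear by (simp add: linear_diff bounded_linear.linear)

lemma projection_idem: "P (P x) = P x"
  using P unfolding orthogonal_projection_def by (metis comp_apply)

lemma projection_adjoint: "cinner (P x) y = cinner x (P y)"
  using P unfolding orthogonal_projection_def by blast

lemma orthogonal_projection_complement: "orthogonal_projection (\<lambda>x. x - P x)"
  unfolding orthogonal_projection_def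
  by (simp add: bounded_clinear_complement projection_bounded_clinear fun_eq_iff projection_diff
      projection_idem cinner_diff_left cinner_diff_right projection_adjoint)

end

section \<open>Schmidt decompositions and eigenbases\<close>

text \<open>For a projection \<open>P\<close> this is an orthonormal basis of the range of
  \<open>P\<close> made of eigenvectors of PQP: as \<open>P b = b\<close>, the vector
  \<open>P (Q b)\<close> is PQP b. Completeness is expressed by a trivial orthogonal complement
  inside that range.\<close>

definition eigenbasis ::
    "('a::complex_inner \<Rightarrow> 'a) \<Rightarrow> ('a \<Rightarrow> 'a) \<Rightarrow> 'a set \<Rightarrow> bool" where
  "eigenbasis P Q B \<longleftrightarrow> orthonormal_system B (\<lambda>b. b) \<and>
     (\<forall>b\<in>B. P b = b \<and> (\<exists>c. P (Q b) = c *\<^sub>C b)) \<and>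
     (\<forall>x. P x = x \<longrightarrow> (\<forall>b\<in>B. cinner x b = 0) \<longrightarrow> x = 0)"

text \<open>On the range of \<open>P\<close> the compression of 1 - Q is the identity minus that of
  \<open>Q\<close>, so each eigenvalue c turns into 1 - c while the vectors stay the same.\<close>

lemma eigenbasis_complement:
  assumes P: "orthogonal_projection P" and B: "eigenbasis P Q B"
  shows "eigenbasis P (\<lambda>x. x - Q x) B"
proof -
  have "\<exists>d. P (b - Q b) = d *\<^sub>C b" if "P b = b" "P (Q b) = c *\<^sub>C b" for b c
    by (rule exI[of _ "1 - c"]) (simp add: projection_diff[OF P] that scaleC_diff_left)
  with B show ?thesis
    unfolding eigenbasis_def by blast
qed

text \<open>The Fourier sum y of x lies in the range of \<open>P\<close>, since \<open>P\<close> is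
  continuous and fixes each term. By self-adjointness \<open>P x - y\<close> is orthogonal to
  \<open>B\<close>, so totality in the range makes it zero.\<close>

lemma eigenbasis_expansion:
  fixes P :: "'a::chilbert_space \<Rightarrow> 'a"
  assumes P: "orthogonal_projection P" and B: "eigenbasis P Q B"
  shows "((\<lambda>b. cinner x b *\<^sub>C b) has_sum P x) B"
proof -
  have Pb: "P b = b" if "b \<in> B" for b
    using B that unfolding eigenbasis_def by blast
  obtain y where y: "((\<lambda>b. cinner x b *\<^sub>C b) has_sum y) B"
    and cy: "\<And>b. b \<in> B \<Longrightarrow> cinner y b = cinner x b"
    using orthonormal_system_has_sum[of B "\<lambda>b. b" x] B unfolding eigenbasis_def by blast
  have "((\<lambda>b. P (cinner x b *\<^sub>C b)) has_sum P y) B"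
    by (rule has_sum_bounded_linear[OF projection_bounded_linear[OF P] y])
  then have "((\<lambda>b. cinner x b *\<^sub>C b) has_sum P y) B"
    by (rule has_sum_cong[THEN iffD1, rotated]) (simp add: projection_scaleC[OF P] Pb)
  then have "P y = y"
    by (rule has_sum_unique) (rule y)
  have "P (P x - y) = P x - y"
    by (simp add: projection_diff[OF P] projection_idem[OF P] \<open>P y = y\<close>)
  moreover have "cinner (P x - y) b = 0" if "b \<in> B" for b
    by (simp add: cinner_diff_left projection_adjoint[OF P] Pb cy that)
  ultimately have "P x - y = 0"
    using B unfolding eigenbasis_def by blast
  with y show ?thesis
    by simp
qed

text \<open>Expanding \<open>P (Q x)\<close> along \<open>B\<close> gives the terms \<langle>x,
  Qb\<rangle> b, and applying \<open>Q\<close> to the expansion of \<open>P x\<close> gives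
  \<langle>x, b\<rangle> Qb. Normalizing the nonzero \<open>Q b\<close> makes their norms the
  singular values in both cases.\<close>

lemma eigenbasis_schmidt:
  fixes P Q :: "'a::chilbert_space \<Rightarrow> 'a"
  assumes P: "orthogonal_projection P" and Q: "orthogonal_projection Q" and B: "eigenbasis P Q B"
  defines "I \<equiv> {b \<in> B. Q b \<noteq> 0}" and "u \<equiv> \<lambda>b. (1 / norm (Q b)) *\<^sub>R Q b"
  shows "schmidt_decomposition (P \<circ> Q) I (\<lambda>b. norm (Q b)) u (\<lambda>b. b)"
    and "schmidt_decomposition (Q \<circ> P) I (\<lambda>b. norm (Q b)) (\<lambda>b. b) u"
proof -
  have on: "cinner b c = (if b = c then 1 else 0)" if "b \<in> B" "c \<in> B" for b c
    using B that unfolding eigenbasis_def orthonormal_system_def by blast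
  then have onI: "orthonormal_system I (\<lambda>b. b)"
    unfolding orthonormal_system_def I_def by blast
  \<comment> \<open>The eigenvector property enters here: \<langle>Qb, Qc\<rangle> = \<langle>Qb,
    Pc\<rangle> = \<langle>PQb, c\<rangle> is a multiple of \<langle>b, c\<rangle>.\<close>
  have orth: "cinner (Q b) (Q c) = 0" if b: "b \<in> B" and c: "c \<in> B" and "b \<noteq> c" for b c
  proof -
    obtain l where l: "P (Q b) = l *\<^sub>C b"
      using B b unfolding eigenbasis_def by blast
    have "P c = c"
      using B c unfolding eigenbasis_def by blast
    then have "cinner (Q b) (Q c) = cinner (Q b) (P c)"
      by (simp add: projection_adjoint[OF Q] projection_idem[OF Q])
    also have "\<dots> = l * cinner b c"
      by (simp add: projection_adjoint[OF P, symmetric] l cinner_scaleC_left)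
    finally show ?thesis
      using on that by simp
  qed
  have onu: "orthonormal_system I u"
    unfolding orthonormal_system_def
    by (auto simp: u_def I_def cinner_scaleR_left cinner_scaleR_right orth cinner_self
        power2_eq_square)
  have pos: "\<forall>b\<in>I. norm (Q b) > 0"
    by (simp add: I_def)
  \<comment> \<open>Passing from \<open>B\<close> to \<open>I\<close> drops only zero terms: if
    \<open>Q b = 0\<close> then \<langle>Qx, b\<rangle> = \<langle>x, Qb\<rangle> = 0.\<close>
  have "((\<lambda>b. norm (Q b) *\<^sub>R (cinner x (u b) *\<^sub>C b)) has_sum P (Q x)) I" for x
  proof -
    have "((\<lambda>b. cinner (Q x) b *\<^sub>C b) has_sum P (Q x)) B"
      by (rule eigenbasis_expansion[OF P B])
    then show ?thesis
      by (rule has_sum_cong_neutral[THEN iffD1, rotated -1])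
        (auto simp: I_def u_def projection_adjoint[OF Q] scaleR_scaleC cinner_scaleR_right)
  qed
  then show "schmidt_decomposition (P \<circ> Q) I (\<lambda>b. norm (Q b)) u (\<lambda>b. b)"
    unfolding schmidt_decomposition_def using onI onu pos by simp
  have "((\<lambda>b. norm (Q b) *\<^sub>R (cinner x b *\<^sub>C u b)) has_sum Q (P x)) I" for x
  proof -
    have "((\<lambda>b. Q (cinner x b *\<^sub>C b)) has_sum Q (P x)) B"
      by (rule has_sum_bounded_linear[OF projection_bounded_linear[OF Q] eigenbasis_expansion[OF P B]])
    then show ?thesis
      by (rule has_sum_cong_neutral[THEN iffD1, rotated -1])
        (auto simp: I_def u_def projection_scaleC[OF Q] scaleR_scaleC scaleC_scaleR)
  qed
  then show "schmidt_decomposition (Q \<circ> P) I (\<lambda>b. norm (Q b)) (\<lambda>b. b) u"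
    unfolding schmidt_decomposition_def using onI onu pos by simp
qed

section \<open>From a Schmidt decomposition to an eigenbasis\<close>

lemma schmidt_apply_right_vector:
  assumes sd: "schmidt_decomposition T I s \<xi> \<psi>" and n: "n \<in> I"
  shows "T (\<xi> n) = s n *\<^sub>R \<psi> n"
proof -
  have "((\<lambda>i. s i *\<^sub>R (cinner (\<xi> n) (\<xi> i) *\<^sub>C \<psi> i)) has_sum T (\<xi> n)) I"
    using sd unfolding schmidt_decomposition_def by blast
  then have "((\<lambda>i. s i *\<^sub>R \<psi> i) has_sum T (\<xi> n)) {n}"
    by (rule has_sum_cong_neutral[THEN iffD1, rotated -1])
      (use sd n in \<open>auto simp: schmidt_decomposition_def orthonormal_system_def\<close>)
  then show ?thesis
    using has_sum_finite[of "{n}" "\<lambda>i. s i *\<^sub>R \<psi> i"] has_sum_unique by fastforce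
qed

text \<open>This is T* \<psi>_n = s_n \<xi>_n in weak form, so that no adjoint of \<open>T\<close>
  has to be constructed.\<close>

lemma schmidt_cinner_left_vector:
  assumes sd: "schmidt_decomposition T I s \<xi> \<psi>" and n: "n \<in> I"
  shows "cinner (T x) (\<psi> n) = s n * cinner x (\<xi> n)"
proof -
  have "((\<lambda>i. s i *\<^sub>R (cinner x (\<xi> i) *\<^sub>C \<psi> i)) has_sum T x) I"
    using sd unfolding schmidt_decomposition_def by blast
  from has_sum_cinner_left[OF this, of "\<psi> n"]
  have "((\<lambda>i. s i * cinner x (\<xi> i)) has_sum cinner (T x) (\<psi> n)) {n}"
    by (rule has_sum_cong_neutral[THEN iffD1, rotated -1])
      (use sd n in \<open>auto simp: schmidt_decomposition_def orthonormal_system_def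
          cinner_scaleR_left cinner_scaleC_left\<close>)
  then show ?thesis
    using has_sum_finite[of "{n}" "\<lambda>i. s i * cinner x (\<xi> i)"] has_sum_unique by fastforce
qed

text \<open>The range of \<open>T\<close> lies in the closed span of the left Schmidt vectors, so
  whatever is orthogonal to these is orthogonal to the range.\<close>

lemma schmidt_cinner_orthogonal:
  assumes sd: "schmidt_decomposition T I s \<xi> \<psi>" and y: "\<And>i. i \<in> I \<Longrightarrow> cinner (\<psi> i) y = 0"
  shows "cinner (T x) y = 0"
proof -
  have "((\<lambda>i. s i *\<^sub>R (cinner x (\<xi> i) *\<^sub>C \<psi> i)) has_sum T x) I"
    using sd unfolding schmidt_decomposition_def by blast
  from has_sum_cinner_left[OF this, of y]
  have "((\<lambda>i. 0) has_sum cinner (T x) y) I"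
    by (rule has_sum_cong[THEN iffD1, rotated])
      (simp add: y cinner_scaleR_left cinner_scaleC_left)
  then show ?thesis
    by (rule has_sum_unique) (simp add: has_sum_0)
qed

lemma schmidt_imp_eigenbasis:
  fixes P Q :: "'a::complex_inner \<Rightarrow> 'a"
  assumes P: "orthogonal_projection P" and Q: "orthogonal_projection Q"
    and sd: "schmidt_decomposition (P \<circ> Q) I s \<xi> \<psi>"
  obtains B where "eigenbasis P Q B"
proof -
  have on\<psi>: "orthonormal_system I \<psi>" and pos: "\<And>i. i \<in> I \<Longrightarrow> s i > 0"
    using sd unfolding schmidt_decomposition_def by auto
  have PQ\<xi>: "P (Q (\<xi> i)) = s i *\<^sub>R \<psi> i" if "i \<in> I" for i
    using schmidt_apply_right_vector[OF sd that] by simp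
  have P\<psi>: "P (\<psi> i) = \<psi> i" if "i \<in> I" for i
  proof -
    have "\<psi> i = (1 / s i) *\<^sub>R P (Q (\<xi> i))"
      using PQ\<xi>[OF that] pos[OF that] by simp
    then show ?thesis
      by (metis projection_idem[OF P] projection_scaleR[OF P])
  qed
  \<comment> \<open>Since \<open>P\<close> fixes \<open>\<psi> i\<close>, the left side is QP
    \<psi>_i, and QP is the adjoint of PQ.\<close>
  have Q\<psi>: "Q (\<psi> i) = s i *\<^sub>R \<xi> i" if "i \<in> I" for i
  proof (rule cinner_ext_right)
    fix z
    have "cinner z (Q (\<psi> i)) = cinner (P (Q z)) (\<psi> i)"
      by (simp add: projection_adjoint[OF P] projection_adjoint[OF Q] P\<psi> that)
    also have "\<dots> = cinner z (s i *\<^sub>R \<xi> i)"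
      using schmidt_cinner_left_vector[OF sd that, of z] by (simp add: cinner_scaleR_right)
    finally show "cinner z (Q (\<psi> i)) = cinner z (s i *\<^sub>R \<xi> i)" .
  qed
  have "orthonormal_system (\<psi> ` I) (\<lambda>b. b)"
    using on\<psi> orthonormal_system_inj_on[OF on\<psi>] unfolding orthonormal_system_def
    by (auto dest: inj_onD)
  moreover have "\<psi> ` I \<subseteq> {x. P x = x}"
    using P\<psi> by auto
  ultimately obtain B where B: "\<psi> ` I \<subseteq> B" "B \<subseteq> {x. P x = x}" "orthonormal_system B (\<lambda>b. b)"
    and total: "\<And>x. P x = x \<Longrightarrow> (\<And>b. b \<in> B \<Longrightarrow> cinner x b = 0) \<Longrightarrow> x = 0"
    by (rule orthonormal_set_extend) (auto simp: projection_scaleC[OF P])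
  have "\<exists>c. P (Q b) = c *\<^sub>C b" if "b \<in> B" for b
  proof (cases "b \<in> \<psi> ` I")
    case True
    then obtain i where "i \<in> I" "b = \<psi> i"
      by blast
    \<comment> \<open>The second \<open>Q\<close> allows both singular relations to be used, PQ
      \<psi>_i = PQ(s_i \<xi>_i) = s_i^2 \<psi>_i.\<close>
    have "P (Q b) = P (Q (Q b))"
      by (simp add: projection_idem[OF Q])
    also have "\<dots> = s i *\<^sub>R s i *\<^sub>R b"
      unfolding \<open>b = \<psi> i\<close> Q\<psi>[OF \<open>i \<in> I\<close>] projection_scaleR[OF Q] projection_scaleR[OF P]
        PQ\<xi>[OF \<open>i \<in> I\<close>] ..
    also have "\<dots> = of_real (s i * s i) *\<^sub>C b"
      unfolding scaleC_of_real by simp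
    finally show ?thesis
      by blast
  next
    case False
    \<comment> \<open>A vector added to the Schmidt vectors is orthogonal to all of them, hence to
      the range of PQ. Then \<langle>z, Qb\<rangle> = \<langle>PQz, b\<rangle> = 0, because
      \<open>P b = b\<close>; the eigenvalue is 0.\<close>
    have "Q b = 0"
    proof (rule cinner_ext_right)
      fix z
      have "cinner (\<psi> i) b = 0" if "i \<in> I" for i
      proof -
        have "\<psi> i \<in> B" and "\<psi> i \<noteq> b"
          using B(1) False that by auto
        with B(3) \<open>b \<in> B\<close> show ?thesis
          unfolding orthonormal_system_def by simp
      qed
      then have "cinner (P (Q z)) b = 0"
        using schmidt_cinner_orthogonal[OF sd, of b z] by simp
      then show "cinner z (Q b) = cinner z 0"
        using B \<open>b \<in> B\<close> by (auto simp: projection_adjoint[OF P] projection_adjoint[OF Q])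
    qed
    then have "P (Q b) = 0 *\<^sub>C b"
      using projection_scaleC[OF P, of 0 0] by simp
    then show ?thesis
      by blast
  qed
  with B total have "eigenbasis P Q B"
    unfolding eigenbasis_def by blast
  then show ?thesis
    by (rule that)
qed

section \<open>Exchange and complement of the projections\<close>

lemma s_decomposable_iff_eigenbasis:
  fixes P Q :: "'a::chilbert_space \<Rightarrow> 'a"
  assumes P: "orthogonal_projection P" and Q: "orthogonal_projection Q"
  shows "s_decomposable (P \<circ> Q) \<longleftrightarrow> (\<exists>B. eigenbasis P Q B)"
proof
  assume "s_decomposable (P \<circ> Q)"
  then show "\<exists>B. eigenbasis P Q B"
    unfolding s_decomposable_def using schmidt_imp_eigenbasis[OF P Q] by metis
next
  assume "\<exists>B. eigenbasis P Q B"
  then obtain B where "eigenbasis P Q B" ..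
  then show "s_decomposable (P \<circ> Q)"
    by (intro s_decomposableI[OF _ eigenbasis_schmidt(1)[OF P Q]] bounded_clinear_compose
        projection_bounded_clinear P Q)
qed

text \<open>One eigenbasis of the range of \<open>P\<close> yields decompositions of PQ and of its
  adjoint QP, with left and right vectors interchanged. The inner claim is stated for all pairs so
  that it gives both directions.\<close>

lemma s_decomposable_commute:
  fixes P Q :: "'a::chilbert_space \<Rightarrow> 'a"
  assumes P: "orthogonal_projection P" and Q: "orthogonal_projection Q"
  shows "s_decomposable (P \<circ> Q) \<longleftrightarrow> s_decomposable (Q \<circ> P)"
proof -
  have "s_decomposable (Q \<circ> P)" if P: "orthogonal_projection P" and Q: "orthogonal_projection Q"
    and PQ: "s_decomposable (P \<circ> Q)" for P Q :: "'a \<Rightarrow> 'a"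
  proof -
    obtain B where "eigenbasis P Q B"
      using PQ s_decomposable_iff_eigenbasis[OF P Q] by blast
    then show ?thesis
      by (intro s_decomposableI[OF _ eigenbasis_schmidt(2)[OF P Q]] bounded_clinear_compose
          projection_bounded_clinear P Q)
  qed
  with P Q show ?thesis
    by blast
qed

lemma s_decomposable_complement_right:
  fixes P Q :: "'a::chilbert_space \<Rightarrow> 'a"
  assumes P: "orthogonal_projection P" and Q: "orthogonal_projection Q"
  shows "s_decomposable (P \<circ> Q) \<longleftrightarrow> s_decomposable (P \<circ> (\<lambda>x. x - Q x))"
proof -
  \<comment> \<open>Complementing twice gives back \<open>Q\<close>, so the one implication also
    supplies its converse.\<close>
  have "eigenbasis P Q B" if "eigenbasis P (\<lambda>x. x - Q x) B" for B
    using eigenbasis_complement[OF P that] by simp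
  then show ?thesis
    using eigenbasis_complement[OF P] s_decomposable_iff_eigenbasis[OF P Q]
      s_decomposable_iff_eigenbasis[OF P orthogonal_projection_complement[OF Q]] by blast
qed

theorem proposition2p7:
  fixes P Q :: "'a::chilbert_space \<Rightarrow> 'a"
  assumes "orthogonal_projection P" and "orthogonal_projection Q"
  shows "(s_decomposable (P \<circ> Q) \<longleftrightarrow> s_decomposable (P \<circ> (\<lambda>x. x - Q x)))
    \<and> (s_decomposable (P \<circ> Q) \<longleftrightarrow> s_decomposable ((\<lambda>x. x - P x) \<circ> Q))
    \<and> (s_decomposable (P \<circ> Q) \<longleftrightarrow> s_decomposable ((\<lambda>x. x - P x) \<circ> (\<lambda>x. x - Q x)))"
proof -
  note P' = orthogonal_projection_complement[OF assms(1)]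
  \<comment> \<open>A complement on the left is reached by exchanging the factors, complementing on
    the right and exchanging back. Complementing \<open>Q\<close> next to 1 - P then gives the last
    equivalence.\<close>
  have "s_decomposable (P \<circ> Q) \<longleftrightarrow> s_decomposable ((\<lambda>x. x - P x) \<circ> Q)"
    using s_decomposable_commute[OF assms] s_decomposable_complement_right[OF assms(2,1)]
      s_decomposable_commute[OF assms(2) P'] by blast
  then show ?thesis
    using s_decomposable_complement_right[OF assms]
      s_decomposable_complement_right[OF P' assms(2)] by blast
qed

end
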